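(* Let $p,q\ge 0$ be integers with $p+q\ge 2$, and let $O(p+1,q+1)$ act on $N^{p,q}\subset\mathbb{R}P^{p+q+1}$ by the action induced from its linear action on $\mathbb{R}^{p+1,q+1}$. Then $O(p+1,q+1)$ preserves the set $\hat{\mathcal H}$ of conformal quadratic hypersurfaces in $N^{p,q}$. Furthermore, for $H,H'\in\hat{\mathcal H}$, there exists $M\in O(p+1,q+1)$ mapping $H$ onto $H'$ if and only if $H$ and $H'$ have the same sign. In particular, if $p=0$ or $q=0$, the action of $O(p+1,q+1)$ on $\hat{\mathcal H}$ is transitive; if $p\neq 0$ and $q\ne 0$, this action has exactly three orbits.
   Context: $\mathbb{R}^{p+1,q+1}$ is the vector space $\mathbb{R}^{p+q+2}$ with coordinates $\xi=(\xi_0,\dots,\xi_{p+q+1})$ and quadratic form $\hat Q(\xi)=\xi_0^2+\xi_1^2+\cdots+\xi_p^2-\xi_{p+1}^2-\cdots-\xi_{p+q+1}^2$; $\hat B$ is the symmetric bilinear form with $\hat B(\xi,\xi)=\hat Q(\xi)$. $O(p+1,q+1)$ is the group of invertible linear maps of $\mathbb{R}^{p+q+2}$ preserving $\hat Q$. $N^{p,q}=\{[\xi]\in\mathbb{R}P^{p+q+1}:\hat Q(\xi)=0\}$; $O(p+1,q+1)$ acts on $\mathbb{R}P^{p+q+1}$ and preserves $N^{p,q}$. Every hyperplane $h\subset\mathbb{R}P^{p+q+1}$ has the form $\{[\xi]:\hat B(a,\xi)=0\}$ for a non-zero vector $a\in\mathbb{R}^{p+1,q+1}$ unique up to scaling.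 The sign of $h$ (positive, negative or zero) is the sign of $\hat Q(a)$. A conformal quadratic hypersurface in $N^{p,q}$ is a set $H=N^{p,q}\cap h$, where $h\subset\mathbb{R}P^{p+q+1}$ is a hyperplane; additionally, if $q=0$ the hyperplane $h$ is required to have positive sign, and if $p=0$ it is required to have negative sign. $\hat{\mathcal H}$ is the set of all conformal quadratic hypersurfaces in $N^{p,q}$. The hyperplane $h$ is uniquely determined by $H\in\hat{\mathcal H}$, and the sign of $H$ is defined to be the sign of $h$. *)

theory Defs
  imports "HOL-Analysis.Analysis" "HOL-Algebra.Group_Action"
begin

text \<open>The signature is carried by two finite index types: \<open>'m\<close> indexes the positive coordinates and
  \<open>'n\<close> the negative ones. Since a finite type is non-empty, \<open>CARD('m) = p + 1\<close> and
  \<open>CARD('n) = q + 1\<close> with \<open>p, q \<ge> 0\<close> arbitrary.\<close>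

type_synonym ('m, 'n) pspace = "(real, 'm + 'n) vec"

definition quad_form :: "('m::finite, 'n::finite) pspace \<Rightarrow> real" where
  "quad_form \<xi> = (\<Sum>i\<in>UNIV. (\<xi> $ Inl i)\<^sup>2) - (\<Sum>j\<in>UNIV. (\<xi> $ Inr j)\<^sup>2)"

definition bil_form :: "('m::finite, 'n::finite) pspace \<Rightarrow> ('m, 'n) pspace \<Rightarrow> real" where
  "bil_form \<xi> \<eta> = (\<Sum>i\<in>UNIV. \<xi> $ Inl i * \<eta> $ Inl i) - (\<Sum>j\<in>UNIV. \<xi> $ Inr j * \<eta> $ Inr j)"

lemma bil_form_self: "bil_form \<xi> \<xi> = quad_form \<xi>"
  by (simp add: bil_form_def quad_form_def power2_eq_square)

lemma bil_form_commute: "bil_form \<xi> \<eta> = bil_form \<eta> \<xi>"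
  by (simp add: bil_form_def mult.commute)

lemma bilinear_bil_form: "bilinear bil_form"
  by (auto simp: bilinear_def bil_form_def algebra_simps sum.distrib sum_distrib_left
      intro!: linearI)

definition pseudo_orthogonal_group ::
    "(('m::finite, 'n::finite) pspace \<Rightarrow> ('m, 'n) pspace) monoid" where
  "pseudo_orthogonal_group =
     \<lparr>carrier = {M. linear M \<and> bij M \<and> (\<forall>\<xi>. quad_form (M \<xi>) = quad_form \<xi>)},
      mult = (\<circ>), one = id\<rparr>"

text \<open>A point \<open>[\<xi>]\<close> of projective space is the line \<open>span {\<xi>}\<close>, so that a linear bijection \<open>M\<close>
  acts on points by taking images: \<open>M ` span {\<xi>} = span {M \<xi>}\<close>.\<close>

definition projective_points :: "'a::real_vector set set" where
  "projective_points = {span {\<xi>} | \<xi>. \<xi> \<noteq> 0}"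

definition projective_image ::
    "('a::real_vector \<Rightarrow> 'a) \<Rightarrow> 'a set set \<Rightarrow> 'a set set" where
  "projective_image M X = (\<lambda>l. M ` l) ` X"

definition projective_hyperplane :: "'a::euclidean_space set set \<Rightarrow> bool" where
  "projective_hyperplane h \<longleftrightarrow>
     (\<exists>W. subspace W \<and> dim W + 1 = DIM('a) \<and> h = {l \<in> projective_points. l \<subseteq> W})"

definition polar_hyperplane ::
    "('m::finite, 'n::finite) pspace \<Rightarrow> ('m, 'n) pspace set set" where
  "polar_hyperplane a = {span {\<xi>} | \<xi>. \<xi> \<noteq> 0 \<and> bil_form a \<xi> = 0}"

definition hyperplane_sign :: "('m::finite, 'n::finite) pspace set set \<Rightarrow> real" where
  "hyperplane_sign h = (THE s. \<exists>a. a \<noteq> 0 \<and> h = polar_hyperplane a \<and> s = sgn (quad_form a))"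

definition null_quadric :: "('m::finite, 'n::finite) pspace set set" where
  "null_quadric = {span {\<xi>} | \<xi>. \<xi> \<noteq> 0 \<and> quad_form \<xi> = 0}"

text \<open>\<open>CARD('n) = 1\<close> is the case \<open>q = 0\<close> and \<open>CARD('m) = 1\<close> the case \<open>p = 0\<close>.\<close>

definition admissible_hyperplane :: "('m::finite, 'n::finite) pspace set set \<Rightarrow> bool" where
  "admissible_hyperplane h \<longleftrightarrow> projective_hyperplane h \<and>
     (CARD('n) = 1 \<longrightarrow> hyperplane_sign h > 0) \<and>
     (CARD('m) = 1 \<longrightarrow> hyperplane_sign h < 0)"

definition conformal_hypersurfaces :: "('m::finite, 'n::finite) pspace set set set" where
  "conformal_hypersurfaces = {null_quadric \<inter> h | h. admissible_hyperplane h}"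

definition hypersurface_sign :: "('m::finite, 'n::finite) pspace set set \<Rightarrow> real" where
  "hypersurface_sign H =
     hyperplane_sign (THE h. admissible_hyperplane h \<and> H = null_quadric \<inter> h)"

text \<open>The library's group actions take values in the functions that are \<open>undefined\<close> off the set
  acted upon, hence the restriction.\<close>

definition hypersurface_action ::
    "(('m::finite, 'n::finite) pspace \<Rightarrow> ('m, 'n) pspace) \<Rightarrow>
     ('m, 'n) pspace set set \<Rightarrow> ('m, 'n) pspace set set" where
  "hypersurface_action M = restrict (projective_image M) conformal_hypersurfaces"

text \<open>Every hyperplane is polar to a non-zero vector, unique up to scaling, so its sign is
  well defined.\<close>

definition flip :: "('m::finite, 'n::finite) pspace \<Rightarrow> ('m, 'n) pspace" where
  "flip a = (\<chi> i. case i of Inl k \<Rightarrow> a $ Inl k | Inr k \<Rightarrow> - (a $ Inr k))"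

lemma flip_flip: "flip (flip a) = a"
  by (simp add: flip_def vec_eq_iff split: sum.split)

lemma flip_scaleR: "flip (c *\<^sub>R a) = c *\<^sub>R flip a"
  by (simp add: flip_def vec_eq_iff split: sum.split)

lemma flip_eq_0_iff: "flip a = 0 \<longleftrightarrow> a = 0"
  by (metis flip_flip flip_scaleR scaleR_zero_left)

lemma bil_form_eq_inner: "bil_form a \<xi> = flip a \<bullet> \<xi>"
  by (simp add: bil_form_def flip_def inner_vec_def UNIV_Plus_UNIV[symmetric] sum.Plus sum_negf
      del: UNIV_Plus_UNIV)

lemma polar_hyperplane_alt:
  "polar_hyperplane a = {l \<in> projective_points. l \<subseteq> {\<xi>. flip a \<bullet> \<xi> = 0}}"
proof -
  have "span {\<xi>} \<subseteq> {\<xi>. flip a \<bullet> \<xi> = 0} \<longleftrightarrow> bil_form a \<xi> = 0" for \<xi>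
    using span_base[of \<xi> "{\<xi>}"] by (auto simp: span_singleton bil_form_eq_inner)
  then show ?thesis
    unfolding polar_hyperplane_def projective_points_def by blast
qed

lemma projective_hyperplane_iff_polar:
  "projective_hyperplane h \<longleftrightarrow> (\<exists>a. a \<noteq> 0 \<and> h = polar_hyperplane a)"
proof
  assume "projective_hyperplane h"
  then obtain W where W: "subspace W" "dim W + 1 = DIM(('a, 'b) pspace)"
      "h = {l \<in> projective_points. l \<subseteq> W}"
    unfolding projective_hyperplane_def by blast
  from W(2) have "dim W = DIM(('a, 'b) pspace) - 1"
    by simp
  then obtain b where b: "b \<noteq> 0" "span W = {x. b \<bullet> x = 0}"
    by (rule lowdim_eq_hyperplane)
  then have "h = polar_hyperplane (flip b)"
    using W(1,3) by (simp add: polar_hyperplane_alt flip_flip span_eq_iff[THEN iffD2])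
  moreover have "flip b \<noteq> 0"
    using b(1) by (simp add: flip_eq_0_iff)
  ultimately show "\<exists>a. a \<noteq> 0 \<and> h = polar_hyperplane a"
    by blast
next
  assume "\<exists>a. a \<noteq> 0 \<and> h = polar_hyperplane a"
  then obtain a where a: "a \<noteq> 0" "h = polar_hyperplane a"
    by blast
  have "dim {x. flip a \<bullet> x = 0} = DIM(('a, 'b) pspace) - 1"
    using a(1) by (intro dim_hyperplane) (simp add: flip_eq_0_iff)
  moreover have "DIM(('a, 'b) pspace) > 0"
    by (rule DIM_positive)
  ultimately have "dim {x. flip a \<bullet> x = 0} + 1 = DIM(('a, 'b) pspace)"
    by linarith
  then show "projective_hyperplane h"
    unfolding projective_hyperplane_def a(2) polar_hyperplane_alt
    using subspace_hyperplane by blast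
qed

lemma polar_hyperplane_eqD:
  assumes "a \<noteq> 0" and "b \<noteq> 0" and eq: "polar_hyperplane a = polar_hyperplane b"
  shows "\<exists>c. c \<noteq> 0 \<and> b = c *\<^sub>R a"
proof -
  define u where "u = flip a"
  define v where "v = flip b"
  have u: "u \<noteq> 0"
    using assms(1) by (simp add: u_def flip_eq_0_iff)
  have *: "v \<bullet> x = 0" if "u \<bullet> x = 0" for x
  proof (cases "x = 0")
    case False
    then have "span {x} \<in> polar_hyperplane a"
      using that by (auto simp: polar_hyperplane_def bil_form_eq_inner u_def)
    then have "span {x} \<subseteq> {\<xi>. v \<bullet> \<xi> = 0}"
      unfolding eq by (simp add: polar_hyperplane_alt v_def)
    then show ?thesis
      using span_base[of x "{x}"] by auto
  qed simp
  define c where "c = (v \<bullet> u) / (u \<bullet> u)"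
  define w where "w = v - c *\<^sub>R u"
  have uw: "u \<bullet> w = 0"
    using u by (simp add: w_def c_def inner_diff_right inner_commute)
  then have "w \<bullet> w = 0"
    using *[OF uw] by (simp add: w_def inner_diff_left)
  then have v: "v = c *\<^sub>R u"
    by (simp add: w_def)
  then have "b = c *\<^sub>R a"
    by (metis u_def v_def flip_flip flip_scaleR)
  then show ?thesis
    using assms(2) by auto
qed

lemma quad_form_scaleR: "quad_form (c *\<^sub>R a) = c\<^sup>2 * quad_form a"
  by (simp add: quad_form_def power_mult_distrib sum_distrib_left right_diff_distrib)

lemma hyperplane_sign_polar:
  assumes "a \<noteq> 0"
  shows "hyperplane_sign (polar_hyperplane a) = sgn (quad_form a)"
  unfolding hyperplane_sign_def
proof (rule the_equality)
  show "\<exists>b. b \<noteq> 0 \<and> polar_hyperplane a = polar_hyperplane b \<and>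
      sgn (quad_form a) = sgn (quad_form b)"
    using assms by blast
next
  fix s
  assume "\<exists>b. b \<noteq> 0 \<and> polar_hyperplane a = polar_hyperplane b \<and> s = sgn (quad_form b)"
  then obtain b where b: "b \<noteq> 0" "polar_hyperplane a = polar_hyperplane b" "s = sgn (quad_form b)"
    by blast
  then obtain c where c: "c \<noteq> 0" "b = c *\<^sub>R a"
    using polar_hyperplane_eqD[OF assms] by blast
  have "sgn (c\<^sup>2) = 1"
    using c(1) by (intro sgn_pos) simp
  then show "s = sgn (quad_form a)"
    unfolding b(3) c(2) quad_form_scaleR sgn_mult by simp
qed

end

theory Submission
  imports Defs
begin

text \<open>
  Write \<open>H\<^sub>a\<close> for the section of the null quadric by the hyperplane polar to a vector \<open>a\<close>. An
  isometry \<open>M\<close> of the form carries \<open>H\<^sub>a\<close> to the section belonging to \<open>M a\<close>, so everything reduces to vectors,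
  once two facts are known.

  First, a hypersurface \<open>H\<^sub>a\<close> determines \<open>a\<close> up to scaling, and so has a sign that isometries
  preserve. If \<open>n\<close> is a null vector orthogonal to \<open>a\<close> and \<open>u\<close> is
  orthogonal to \<open>a\<close> but not to \<open>n\<close>, then the line \<open>u + t n\<close> contains a null vector; hence any \<open>b\<close> that
  is orthogonal to all null vectors of the hyperplane \<open>a\<^sup>\<bottom>\<close> is orthogonal to \<open>u\<close>. Every vector of
  \<open>a\<^sup>\<bottom>\<close> is a difference of two such \<open>u\<close>, as soon as there is one, and there is one as soon as \<open>n\<close> is
  not a multiple of \<open>a\<close>. Such an \<open>n\<close> is found by choosing unit vectors \<open>x\<close> and \<open>y\<close> in the positive and
  negative parts that have equal inner products with the two parts of \<open>a\<close>; this is where the sign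
  conditions on the hyperplane for \<open>p = 0\<close> and \<open>q = 0\<close> enter.

  Second, two non-zero vectors with the same value of the quadratic form are related by an isometry
  (the case of Witt's theorem for lines). If their difference is not null, the reflection in it
  exchanges them; if the vectors are not null but their difference is, the reflection in their sum
  takes one to the negative of the other. If the two vectors and their difference are all null, one
  goes through a third null vector that is not orthogonal to either.

  After rescaling, the two facts give: \<open>H\<^sub>a\<close> and \<open>H\<^sub>b\<close> are equivalent if and only if the form has the
  same sign on \<open>a\<close> and \<open>b\<close>. The orbits are thus counted by the signs that occur: one if \<open>p = 0\<close> or
  \<open>q = 0\<close>, and all three otherwise.
\<close>

section \<open>The form on the positive and negative parts\<close>

lemma bil_form_linear_simps:
  "bil_form (a + b) c = bil_form a c + bil_form b c"
  "bil_form a (b + c) = bil_form a b + bil_form a c"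
  "bil_form (a - b) c = bil_form a c - bil_form b c"
  "bil_form a (b - c) = bil_form a b - bil_form a c"
  "bil_form (r *\<^sub>R a) b = r * bil_form a b"
  "bil_form a (r *\<^sub>R b) = r * bil_form a b"
  "bil_form (- a) b = - bil_form a b"
  "bil_form a (- b) = - bil_form a b"
  "bil_form 0 b = 0"
  "bil_form a 0 = 0"
  using bilinear_ladd[OF bilinear_bil_form] bilinear_radd[OF bilinear_bil_form]
    bilinear_lsub[OF bilinear_bil_form] bilinear_rsub[OF bilinear_bil_form]
    bilinear_lmul[OF bilinear_bil_form] bilinear_rmul[OF bilinear_bil_form]
    bilinear_lneg[OF bilinear_bil_form] bilinear_rneg[OF bilinear_bil_form]
    bilinear_lzero[OF bilinear_bil_form] bilinear_rzero[OF bilinear_bil_form]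
  by simp_all

lemma quad_form_add: "quad_form (a + b) = quad_form a + 2 * bil_form a b + quad_form b"
  by (simp add: bil_form_self[symmetric] bil_form_linear_simps bil_form_commute[of b a])

lemma quad_form_diff: "quad_form (a - b) = quad_form a - 2 * bil_form a b + quad_form b"
  by (simp add: bil_form_self[symmetric] bil_form_linear_simps bil_form_commute[of b a])

lemma quad_form_minus: "quad_form (- a) = quad_form a"
  by (simp add: bil_form_self[symmetric] bil_form_linear_simps)

lemma quad_form_flip: "quad_form (flip a) = quad_form a"
  by (simp add: quad_form_def flip_def)

definition pos_part :: "('m::finite, 'n::finite) pspace \<Rightarrow> real ^ 'm" where
  "pos_part a = (\<chi> i. a $ Inl i)"

definition neg_part :: "('m::finite, 'n::finite) pspace \<Rightarrow> real ^ 'n" where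
  "neg_part a = (\<chi> j. a $ Inr j)"

definition join_parts :: "real ^ 'm \<Rightarrow> real ^ 'n \<Rightarrow> ('m::finite, 'n::finite) pspace" where
  "join_parts x y = (\<chi> k. case k of Inl i \<Rightarrow> x $ i | Inr j \<Rightarrow> y $ j)"

lemma pos_part_join [simp]: "pos_part (join_parts x y) = x"
  by (simp add: pos_part_def join_parts_def vec_eq_iff)

lemma neg_part_join [simp]: "neg_part (join_parts x y) = y"
  by (simp add: neg_part_def join_parts_def vec_eq_iff)

lemma pos_part_scaleR: "pos_part (c *\<^sub>R a) = c *\<^sub>R pos_part a"
  by (simp add: pos_part_def vec_eq_iff)

lemma pos_part_zero [simp]: "pos_part 0 = 0"
  by (simp add: pos_part_def vec_eq_iff)

lemma neg_part_zero [simp]: "neg_part 0 = 0"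
  by (simp add: neg_part_def vec_eq_iff)

lemma bil_form_parts: "bil_form a b = pos_part a \<bullet> pos_part b - neg_part a \<bullet> neg_part b"
  by (simp add: bil_form_def pos_part_def neg_part_def inner_vec_def)

lemma quad_form_parts: "quad_form a = (norm (pos_part a))\<^sup>2 - (norm (neg_part a))\<^sup>2"
  by (simp add: bil_form_self[symmetric] bil_form_parts power2_norm_eq_inner)

section \<open>Null vectors in a polar hyperplane\<close>

text \<open>The sphere is connected, so the inner product with \<open>v\<close> takes on it all values between the
  extreme ones at \<open>\<plusminus> v / \<bar>v\<bar>\<close>.\<close>

lemma unit_vector_with_inner:
  fixes v :: "'a::euclidean_space"
  assumes "2 \<le> DIM('a)" and "\<bar>s\<bar> \<le> norm v"
  obtains x where "norm x = 1" and "v \<bullet> x = s"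
proof (cases "v = 0")
  case True
  obtain x :: 'a where "norm x = 1"
    by (rule vector_choose_size[of 1]) auto
  with True assms(2) that show ?thesis
    by simp
next
  case False
  have "connected ((\<lambda>x. v \<bullet> x) ` sphere 0 1)"
    by (intro connected_continuous_image continuous_intros connected_sphere assms(1))
  moreover have "norm v \<in> (\<lambda>x. v \<bullet> x) ` sphere 0 1"
    using False
    by (intro image_eqI[of _ _ "v /\<^sub>R norm v"])
      (auto simp: power2_norm_eq_inner[symmetric] power2_eq_square)
  moreover have "- norm v \<in> (\<lambda>x. v \<bullet> x) ` sphere 0 1"
    using False
    by (intro image_eqI[of _ _ "- (v /\<^sub>R norm v)"])
      (auto simp: power2_norm_eq_inner[symmetric] power2_eq_square)
  ultimately have "{- norm v .. norm v} \<subseteq> (\<lambda>x. v \<bullet> x) ` sphere 0 1"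
    using connected_contains_Icc by blast
  moreover have "s \<in> {- norm v .. norm v}"
    using assms(2) by auto
  ultimately show ?thesis
    using that by auto
qed

text \<open>The condition on a hyperplane that it may cut out a hypersurface, expressed by its polar
  vector.\<close>

definition admissible_vector :: "('m::finite, 'n::finite) pspace \<Rightarrow> bool" where
  "admissible_vector a \<longleftrightarrow> a \<noteq> 0 \<and> (CARD('n) = 1 \<longrightarrow> quad_form a > 0) \<and>
     (CARD('m) = 1 \<longrightarrow> quad_form a < 0)"

lemma card_finite_cases: "CARD('k::finite) = 1 \<or> CARD('k) \<ge> 2"
proof -
  have "CARD('k) > 0"
    by simp
  then show ?thesis
    by linarith
qed

text \<open>A pair of unit vectors \<open>x\<close>, \<open>y\<close> is null, and it is orthogonal to \<open>a = (a\<^sub>1, a\<^sub>2)\<close> when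
  \<open>a\<^sub>1 \<bullet> x = a\<^sub>2 \<bullet> y\<close>. If one part is a line, its unit vector is prescribed up to sign, and the sign
  of the form on \<open>a\<close> leaves room to choose the other one; otherwise both inner products can be made
  zero, which excludes multiples of \<open>a\<close>.\<close>

lemma admissible_vector_null_orthogonal:
  fixes a :: "('m::finite, 'n::finite) pspace"
  assumes "admissible_vector a"
  obtains n where "quad_form n = 0" and "bil_form a n = 0" and "n \<notin> span {a}"
proof -
  note found = that
  have two_parts: thesis
    if xy: "norm x = 1" "norm y = 1" "pos_part a \<bullet> x = neg_part a \<bullet> y"
      and indep: "quad_form a \<noteq> 0 \<or> pos_part a \<bullet> x = 0" for x y
  proof (rule found[of "join_parts x y"])
    show null: "quad_form (join_parts x y) = 0"
      using xy by (simp add: quad_form_parts)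
    show "bil_form a (join_parts x y) = 0"
      using xy by (simp add: bil_form_parts)
    show "join_parts x y \<notin> span {a}"
    proof
      assume "join_parts x y \<in> span {a}"
      then obtain c where c: "join_parts x y = c *\<^sub>R a"
        by (auto simp: span_singleton)
      then have x: "x = c *\<^sub>R pos_part a"
        by (metis pos_part_join pos_part_scaleR)
      then have "c \<noteq> 0"
        using xy(1) by auto
      then have "quad_form a = 0"
        using null by (simp add: c quad_form_scaleR)
      then have "pos_part a \<bullet> x = 0"
        using indep by simp
      then have "x \<bullet> x = 0"
        by (subst x) simp
      with xy(1) show False
        by auto
    qed
  qed
  show thesis
  proof (cases "CARD('n) = 1")
    case True
    then have pos: "quad_form a > 0"
      using assms by (simp add: admissible_vector_def)
    then have "CARD('m) \<noteq> 1"
      using assms by (auto simp: admissible_vector_def)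
    then have dim: "2 \<le> DIM(real ^ 'm)"
      using card_finite_cases[where ?'k = 'm] by simp
    obtain y :: "real ^ 'n" where y: "norm y = 1"
      by (rule vector_choose_size[of 1]) auto
    have "\<bar>neg_part a \<bullet> y\<bar> \<le> norm (neg_part a)"
      using Cauchy_Schwarz_ineq2[of "neg_part a" y] y by simp
    also have "\<dots> \<le> norm (pos_part a)"
      using pos power2_less_imp_less[of "norm (neg_part a)" "norm (pos_part a)"]
      by (simp add: quad_form_parts)
    finally obtain x where "norm x = 1" "pos_part a \<bullet> x = neg_part a \<bullet> y"
      using unit_vector_with_inner[OF dim] by metis
    with y pos show thesis
      by (intro two_parts[of x y]) auto
  next
    case n: False
    then have dimn: "2 \<le> DIM(real ^ 'n)"
      using card_finite_cases[where ?'k = 'n] by simp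
    show thesis
    proof (cases "CARD('m) = 1")
      case True
      then have neg: "quad_form a < 0"
        using assms by (simp add: admissible_vector_def)
      obtain x :: "real ^ 'm" where x: "norm x = 1"
        by (rule vector_choose_size[of 1]) auto
      have "\<bar>pos_part a \<bullet> x\<bar> \<le> norm (pos_part a)"
        using Cauchy_Schwarz_ineq2[of "pos_part a" x] x by simp
      also have "\<dots> \<le> norm (neg_part a)"
        using neg power2_less_imp_less[of "norm (pos_part a)" "norm (neg_part a)"]
        by (simp add: quad_form_parts)
      finally obtain y where "norm y = 1" "neg_part a \<bullet> y = pos_part a \<bullet> x"
        using unit_vector_with_inner[OF dimn] by metis
      with x neg show thesis
        by (intro two_parts[of x y]) auto
    next
      case False
      then have dimm: "2 \<le> DIM(real ^ 'm)"
        using card_finite_cases[where ?'k = 'm] by simp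
      obtain x where "norm x = 1" "pos_part a \<bullet> x = 0"
        using unit_vector_with_inner[OF dimm, of 0 "pos_part a"] by auto
      moreover obtain y where "norm y = 1" "neg_part a \<bullet> y = 0"
        using unit_vector_with_inner[OF dimn, of 0 "neg_part a"] by auto
      ultimately show thesis
        by (intro two_parts[of x y]) auto
    qed
  qed
qed

text \<open>Null vectors span the hyperplane: adding a multiple of \<open>n\<close> makes any vector in it null that
  is not orthogonal to \<open>n\<close>, and the others are differences of two such vectors.\<close>

lemma orthogonal_to_null_section:
  fixes a b :: "('m::finite, 'n::finite) pspace"
  assumes n: "quad_form n = 0" "bil_form a n = 0" "n \<notin> span {a}"
    and b: "\<And>\<xi>. quad_form \<xi> = 0 \<Longrightarrow> bil_form a \<xi> = 0 \<Longrightarrow> bil_form b \<xi> = 0"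
    and u: "bil_form a u = 0"
  shows "bil_form b u = 0"
proof -
  have bn: "bil_form b n = 0"
    using b n by blast
  have generic: "bil_form b v = 0" if v: "bil_form a v = 0" "bil_form n v \<noteq> 0" for v
  proof -
    define t where "t = - quad_form v / (2 * bil_form n v)"
    have "quad_form (v + t *\<^sub>R n) = 0"
      using v(2) n(1)
      by (simp add: quad_form_add quad_form_diff quad_form_scaleR bil_form_linear_simps
          bil_form_commute[of v n] t_def)
    moreover have "bil_form a (v + t *\<^sub>R n) = 0"
      using v(1) n(2) by (simp add: bil_form_linear_simps)
    ultimately have "bil_form b (v + t *\<^sub>R n) = 0"
      by (rule b)
    then show ?thesis
      using bn by (simp add: bil_form_linear_simps)
  qed
  \<comment> \<open>The component of \<open>n\<close> that is Euclidean-orthogonal to \<open>a\<close>; its flip lies in the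
    hyperplane polar to \<open>a\<close> but is not orthogonal to \<open>n\<close> for the form.\<close>
  define w where "w = n - (a \<bullet> n / (a \<bullet> a)) *\<^sub>R a"
  have "w \<noteq> 0"
    using n(3) by (auto simp: w_def span_singleton)
  have aw: "a \<bullet> w = 0"
    by (cases "a = 0") (simp_all add: w_def inner_diff_right)
  have flip_w: "bil_form c (flip w) = c \<bullet> w" for c
    by (metis bil_form_commute bil_form_eq_inner flip_flip inner_commute)
  have "n = w + (a \<bullet> n / (a \<bullet> a)) *\<^sub>R a"
    by (simp add: w_def)
  then have "n \<bullet> w = w \<bullet> w"
    using aw by (metis add.right_neutral inner_add_left inner_scaleR_left mult_zero_right)
  then have w: "bil_form a (flip w) = 0" "bil_form n (flip w) \<noteq> 0"
    using aw \<open>w \<noteq> 0\<close> by (simp_all add: flip_w)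
  show ?thesis
  proof (cases "bil_form n u = 0")
    case True
    then have "bil_form b (u + flip w) = 0"
      using w u by (intro generic) (simp_all add: bil_form_linear_simps)
    then show ?thesis
      using generic[OF w] by (simp add: bil_form_linear_simps)
  next
    case False
    with u show ?thesis
      by (rule generic)
  qed
qed

section \<open>Hypersurfaces and their polar vectors\<close>

definition polar_section :: "('m::finite, 'n::finite) pspace \<Rightarrow> ('m, 'n) pspace set set" where
  "polar_section a = null_quadric \<inter> polar_hyperplane a"

lemma span_in_polar_hyperplane_iff:
  "span {\<xi>} \<in> polar_hyperplane a \<longleftrightarrow> \<xi> \<noteq> 0 \<and> bil_form a \<xi> = 0"
proof
  assume *: "span {\<xi>} \<in> polar_hyperplane a"
  then have "bil_form a \<xi> = 0"
    using span_base[of \<xi> "{\<xi>}"] by (auto simp: polar_hyperplane_alt bil_form_eq_inner)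
  moreover obtain \<eta> where "\<eta> \<noteq> 0" "span {\<xi>} = span {\<eta>}"
    using * by (auto simp: polar_hyperplane_def)
  then have "\<xi> \<noteq> 0"
    using span_base[of \<eta> "{\<eta>}"] by auto
  ultimately show "\<xi> \<noteq> 0 \<and> bil_form a \<xi> = 0"
    by simp
qed (auto simp: polar_hyperplane_def)

lemma polar_section_eq:
  "polar_section a = {span {\<xi>} | \<xi>. \<xi> \<noteq> 0 \<and> quad_form \<xi> = 0 \<and> bil_form a \<xi> = 0}"
  by (auto simp: polar_section_def null_quadric_def span_in_polar_hyperplane_iff)

lemma polar_hyperplane_scaleR:
  assumes "c \<noteq> 0"
  shows "polar_hyperplane (c *\<^sub>R a) = polar_hyperplane a"
  using assms by (simp add: polar_hyperplane_def bil_form_linear_simps)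

text \<open>Used in both directions, this shows that a hypersurface comes from one hyperplane only, so that
  its sign is well defined.\<close>

lemma polar_section_subset_imp:
  fixes a b :: "('m::finite, 'n::finite) pspace"
  assumes a: "admissible_vector a" and sub: "polar_section a \<subseteq> polar_section b"
  shows "polar_hyperplane a \<subseteq> polar_hyperplane b"
proof -
  obtain n where n: "quad_form n = 0" "bil_form a n = 0" "n \<notin> span {a}"
    using admissible_vector_null_orthogonal[OF a] .
  have "bil_form b \<xi> = 0" if "quad_form \<xi> = 0" "bil_form a \<xi> = 0" for \<xi>
  proof (cases "\<xi> = 0")
    case False
    then have "span {\<xi>} \<in> polar_section b"
      using that sub by (auto simp: polar_section_eq)
    then show ?thesis
      by (simp add: polar_section_def span_in_polar_hyperplane_iff)
  qed (simp add: bil_form_linear_simps)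
  from orthogonal_to_null_section[OF n this] show ?thesis
    by (auto simp: polar_hyperplane_def)
qed

lemma admissible_hyperplane_iff:
  fixes h :: "('m::finite, 'n::finite) pspace set set"
  shows "admissible_hyperplane h \<longleftrightarrow> (\<exists>a. admissible_vector a \<and> h = polar_hyperplane a)"
  unfolding admissible_hyperplane_def projective_hyperplane_iff_polar admissible_vector_def
  by (auto simp: hyperplane_sign_polar)

lemma conformal_hypersurfaces_eq:
  "conformal_hypersurfaces = {polar_section a | a. admissible_vector a}"
  unfolding conformal_hypersurfaces_def polar_section_def admissible_hyperplane_iff by blast

lemma hypersurface_sign_polar_section:
  fixes a :: "('m::finite, 'n::finite) pspace"
  assumes a: "admissible_vector a"
  shows "hypersurface_sign (polar_section a) = sgn (quad_form a)"
proof -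
  have "(THE h. admissible_hyperplane h \<and> polar_section a = null_quadric \<inter> h) = polar_hyperplane a"
  proof (rule the_equality)
    show "admissible_hyperplane (polar_hyperplane a) \<and>
        polar_section a = null_quadric \<inter> polar_hyperplane a"
      using a by (auto simp: admissible_hyperplane_iff polar_section_def)
  next
    fix h
    assume h: "admissible_hyperplane h \<and> polar_section a = null_quadric \<inter> h"
    then obtain b where b: "admissible_vector b" "h = polar_hyperplane b"
      by (auto simp: admissible_hyperplane_iff)
    with h have "polar_section a = polar_section b"
      by (simp add: polar_section_def)
    with a b show "h = polar_hyperplane a"
      using polar_section_subset_imp by blast
  qed
  moreover have "a \<noteq> 0"
    using a by (simp add: admissible_vector_def)
  ultimately show ?thesis
    by (simp add: hypersurface_sign_def hyperplane_sign_polar)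
qed

section \<open>The pseudo-orthogonal group\<close>

lemma mem_pseudo_orthogonal_group:
  "M \<in> carrier pseudo_orthogonal_group \<longleftrightarrow>
     linear M \<and> bij M \<and> (\<forall>\<xi>. quad_form (M \<xi>) = quad_form \<xi>)"
  by (simp add: pseudo_orthogonal_group_def)

lemma mult_pseudo_orthogonal_group: "M \<otimes>\<^bsub>pseudo_orthogonal_group\<^esub> N = M \<circ> N"
  by (simp add: pseudo_orthogonal_group_def)

lemma group_pseudo_orthogonal_group:
  "group (pseudo_orthogonal_group :: (('m::finite, 'n::finite) pspace \<Rightarrow> _) monoid)"
proof (rule groupI)
  fix M :: "('m, 'n) pspace \<Rightarrow> ('m, 'n) pspace"
  assume M: "M \<in> carrier pseudo_orthogonal_group"
  then have "linear M" and bij: "bij M" and quad: "quad_form (M \<xi>) = quad_form \<xi>" for \<xi>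
    by (auto simp: mem_pseudo_orthogonal_group)
  have "linear (inv_into UNIV M)"
    using bij \<open>linear M\<close> by (metis bij_betw_def inj_linear_imp_inv_linear)
  moreover have "quad_form (inv_into UNIV M \<xi>) = quad_form \<xi>" for \<xi>
    using quad[of "inv_into UNIV M \<xi>"] bij by (simp add: bij_is_surj surj_f_inv_f)
  ultimately have "inv_into UNIV M \<in> carrier pseudo_orthogonal_group"
    using bij by (simp add: mem_pseudo_orthogonal_group bij_imp_bij_inv)
  moreover have "inv_into UNIV M \<circ> M = id"
    using bij by (simp add: bij_is_inj)
  ultimately show "\<exists>N \<in> carrier pseudo_orthogonal_group.
      N \<otimes>\<^bsub>pseudo_orthogonal_group\<^esub> M = \<one>\<^bsub>pseudo_orthogonal_group\<^esub>"
    by (auto simp: pseudo_orthogonal_group_def)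
qed (auto simp: pseudo_orthogonal_group_def linear_compose bij_comp comp_assoc linear_id)

text \<open>Polarization: the quadratic form determines the bilinear one.\<close>

lemma bil_form_preserved:
  assumes "M \<in> carrier pseudo_orthogonal_group"
  shows "bil_form (M a) (M b) = bil_form a b"
proof -
  have "quad_form (M a + M b) = quad_form (a + b)"
    using assms by (metis linear_add mem_pseudo_orthogonal_group)
  then show ?thesis
    using assms by (simp add: quad_form_add mem_pseudo_orthogonal_group)
qed

lemma projective_image_polar_section:
  assumes M: "M \<in> carrier pseudo_orthogonal_group"
  shows "projective_image M (polar_section a) = polar_section (M a)"
proof -
  have lin: "linear M" and bij: "bij M" and quad: "quad_form (M \<xi>) = quad_form \<xi>" for \<xi>
    using M by (auto simp: mem_pseudo_orthogonal_group)
  have line: "M ` span {\<xi>} = span {M \<xi>}" for \<xi>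
    using linear_span_image[OF lin, of "{\<xi>}"] by simp
  have nonzero: "M \<xi> \<noteq> 0 \<longleftrightarrow> \<xi> \<noteq> 0" for \<xi>
    using lin bij by (metis bij_is_inj injD linear_0)
  have surj: "(\<exists>\<xi>. P (M \<xi>)) \<longleftrightarrow> (\<exists>\<xi>. P \<xi>)" for P
    using bij_is_surj[OF bij] by (metis surj_def)
  have "projective_image M (polar_section a) =
      {M ` span {\<xi>} | \<xi>. \<xi> \<noteq> 0 \<and> quad_form \<xi> = 0 \<and> bil_form a \<xi> = 0}"
    by (auto simp: projective_image_def polar_section_eq)
  also have "\<dots> = {span {M \<xi>} | \<xi>. M \<xi> \<noteq> 0 \<and> quad_form (M \<xi>) = 0 \<and> bil_form (M a) (M \<xi>) = 0}"
    by (simp add: line nonzero quad bil_form_preserved[OF M])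
  also have "\<dots> = polar_section (M a)"
    unfolding polar_section_eq
    by (subst surj[of "\<lambda>\<xi>. _ = span {\<xi>} \<and> \<xi> \<noteq> 0 \<and> quad_form \<xi> = 0 \<and> bil_form (M a) \<xi> = 0"])
      (rule refl)
  finally show ?thesis .
qed

lemma admissible_vector_image:
  assumes M: "M \<in> carrier pseudo_orthogonal_group" and "admissible_vector a"
  shows "admissible_vector (M a)"
proof -
  have "M a \<noteq> 0"
    using assms by (metis admissible_vector_def bij_is_inj injD linear_0
        mem_pseudo_orthogonal_group)
  then show ?thesis
    using assms by (simp add: admissible_vector_def mem_pseudo_orthogonal_group)
qed

lemma projective_image_comp:
  "projective_image (M \<circ> N) X = projective_image M (projective_image N X)"
  by (simp add: projective_image_def image_comp comp_def)

lemma projective_image_conformal_hypersurface: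
  assumes "M \<in> carrier pseudo_orthogonal_group" and "H \<in> conformal_hypersurfaces"
  shows "projective_image M H \<in> conformal_hypersurfaces"
    and "hypersurface_sign (projective_image M H) = hypersurface_sign H"
  using assms
  by (auto simp: conformal_hypersurfaces_eq projective_image_polar_section admissible_vector_image
      hypersurface_sign_polar_section mem_pseudo_orthogonal_group[of M])

lemma projective_image_conformal_hypersurfaces:
  fixes M :: "('m::finite, 'n::finite) pspace \<Rightarrow> ('m, 'n) pspace"
  assumes M: "M \<in> carrier pseudo_orthogonal_group"
  shows "bij_betw (projective_image M) conformal_hypersurfaces conformal_hypersurfaces"
proof -
  interpret group "pseudo_orthogonal_group :: (('m, 'n) pspace \<Rightarrow> ('m, 'n) pspace) monoid"
    by (rule group_pseudo_orthogonal_group)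
  obtain N where N: "N \<in> carrier pseudo_orthogonal_group" "M \<circ> N = id" "N \<circ> M = id"
    using l_inv[OF M] r_inv[OF M] inv_closed[OF M]
    by (auto simp: pseudo_orthogonal_group_def)
  have "projective_image id X = X" for X :: "('m, 'n) pspace set set"
    by (simp add: projective_image_def)
  then show ?thesis
    using M N projective_image_conformal_hypersurface(1)
    by (intro bij_betw_byWitness[where f' = "projective_image N"])
      (auto simp: projective_image_comp[symmetric])
qed

section \<open>Reflections and transitivity on vectors of equal norm\<close>

definition reflection :: "('m::finite, 'n::finite) pspace \<Rightarrow> ('m, 'n) pspace \<Rightarrow> ('m, 'n) pspace" where
  "reflection v x = x - (2 * bil_form v x / quad_form v) *\<^sub>R v"

lemma reflection_in_group:
  assumes v: "quad_form v \<noteq> 0"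
  shows "reflection v \<in> carrier pseudo_orthogonal_group"
  unfolding mem_pseudo_orthogonal_group
proof (intro conjI allI)
  show "linear (reflection v)"
    by (rule linearI)
      (simp_all add: reflection_def bil_form_linear_simps algebra_simps add_divide_distrib)
  have "reflection v (reflection v x) = x" for x
    using v by (simp add: reflection_def bil_form_linear_simps bil_form_self field_simps)
  then show "bij (reflection v)"
    by (intro o_bij[of "reflection v"]) auto
  show "quad_form (reflection v x) = quad_form x" for x
    using v
    by (simp add: reflection_def quad_form_diff quad_form_scaleR bil_form_linear_simps
        bil_form_commute[of x v] power2_eq_square)
qed

lemma uminus_in_group: "uminus \<in> carrier pseudo_orthogonal_group"
  by (auto simp: mem_pseudo_orthogonal_group quad_form_minus bij_uminus linear_uminus
      intro!: linearI)

text \<open>When the form agrees on \<open>a\<close> and \<open>b\<close>, their sum is orthogonal to their difference; so the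
  reflection fixes \<open>a + b\<close> and negates \<open>a - b\<close>.\<close>

lemma reflection_exchanges:
  assumes "quad_form a = quad_form b" and "quad_form (a - b) \<noteq> 0"
  shows "reflection (a - b) a = b"
proof -
  have "2 * bil_form (a - b) a = quad_form (a - b)"
    using assms(1)
    by (simp add: quad_form_diff bil_form_linear_simps bil_form_self bil_form_commute[of b a])
  with assms(2) show ?thesis
    by (simp add: reflection_def)
qed

text \<open>If the form agrees on \<open>a\<close> and \<open>b\<close>, the parallelogram law says that its values on \<open>a - b\<close> and \<open>a + b\<close> add up to
  four times its value on \<open>a\<close>, so one of the two can be reflected in.\<close>

lemma nonnull_vectors_equivalent:
  assumes "quad_form a = quad_form b" and "quad_form a \<noteq> 0"
  shows "\<exists>M \<in> carrier pseudo_orthogonal_group. M a = b"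
proof (cases "quad_form (a - b) = 0")
  case False
  with assms(1) show ?thesis
    using reflection_in_group reflection_exchanges by blast
next
  case True
  have "quad_form (a - b) + quad_form (a + b) = 4 * quad_form a"
    using assms(1) by (simp add: quad_form_diff quad_form_add)
  with True assms(2) have "quad_form (a - (- b)) \<noteq> 0"
    by simp
  then have "reflection (a - (- b)) a = - b" "reflection (a - (- b)) \<in> carrier pseudo_orthogonal_group"
    using assms(1) reflection_exchanges[of a "- b"] reflection_in_group
    by (auto simp: quad_form_minus)
  then have "(uminus \<circ> reflection (a - (- b))) a = b"
    "uminus \<circ> reflection (a - (- b)) \<in> carrier pseudo_orthogonal_group"
    using monoid.m_closed[OF group.is_monoid[OF group_pseudo_orthogonal_group] uminus_in_group]
    by (auto simp: mult_pseudo_orthogonal_group)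
  then show ?thesis
    by blast
qed

text \<open>The form pairs \<open>x\<close> with \<open>flip y\<close> as the Euclidean inner product pairs \<open>x\<close> with \<open>y\<close>, so
  \<open>flip a\<close> is a null vector not orthogonal to \<open>a\<close>, and \<open>flip b\<close> one not orthogonal to \<open>b\<close>. If neither
  of them works for both vectors, \<open>a\<close> and \<open>b\<close> are Euclidean-orthogonal and their sum can be flipped.\<close>

lemma common_nonorthogonal_null_vector:
  assumes "a \<noteq> 0" "b \<noteq> 0" and "quad_form a = 0" "quad_form b = 0" and "bil_form a b = 0"
  obtains c where "quad_form c = 0" and "bil_form a c \<noteq> 0" and "bil_form b c \<noteq> 0"
proof -
  have pair: "bil_form x (flip y) = x \<bullet> y" for x y :: "('a, 'b) pspace"
    by (metis bil_form_commute bil_form_eq_inner flip_flip inner_commute)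
  show thesis
  proof (cases "a \<bullet> b = 0")
    case False
    then show thesis
      using assms by (intro that[of "flip a"]) (auto simp: pair quad_form_flip inner_commute)
  next
    case True
    then show thesis
      using assms
      by (intro that[of "flip (a + b)"])
        (auto simp: pair quad_form_flip quad_form_add inner_add_right inner_commute)
  qed
qed

text \<open>For null vectors, \<open>quad_form (a - b)\<close> is a non-zero multiple of \<open>bil_form a b\<close>, so one reflection
  suffices unless the two are orthogonal.\<close>

lemma null_vectors_equivalent:
  assumes "a \<noteq> 0" "b \<noteq> 0" and "quad_form a = 0" "quad_form b = 0"
  shows "\<exists>M \<in> carrier pseudo_orthogonal_group. M a = b"
proof -
  have step: "reflection (x - y) \<in> carrier pseudo_orthogonal_group \<and> reflection (x - y) x = y"
    if "quad_form x = 0" "quad_form y = 0" "bil_form x y \<noteq> 0" for x y :: "('a, 'b) pspace"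
    using that by (auto intro!: reflection_in_group reflection_exchanges simp: quad_form_diff)
  show ?thesis
  proof (cases "bil_form a b = 0")
    case False
    with assms show ?thesis
      using step by blast
  next
    case True
    with assms obtain c where c: "quad_form c = 0" "bil_form a c \<noteq> 0" "bil_form c b \<noteq> 0"
      by (metis common_nonorthogonal_null_vector bil_form_commute)
    have "reflection (c - b) \<otimes>\<^bsub>pseudo_orthogonal_group\<^esub> reflection (a - c)
        \<in> carrier pseudo_orthogonal_group"
      using step assms c
      by (intro monoid.m_closed[OF group.is_monoid[OF group_pseudo_orthogonal_group]]) auto
    moreover have "(reflection (c - b) \<circ> reflection (a - c)) a = b"
      using step assms c by simp
    ultimately show ?thesis
      by (metis mult_pseudo_orthogonal_group)
  qed
qed

text \<open>Vectors of the same sign can be rescaled to have the same value of the form, and rescaling does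
  not change the polar hyperplane.\<close>

lemma polar_sections_equivalent:
  assumes "a \<noteq> 0" "b \<noteq> 0" and sgn: "sgn (quad_form a) = sgn (quad_form b)"
  shows "\<exists>M \<in> carrier pseudo_orthogonal_group. projective_image M (polar_section a) = polar_section b"
proof -
  obtain r where r: "r \<noteq> 0" "quad_form (r *\<^sub>R b) = quad_form a"
  proof (cases "quad_form b = 0")
    case True
    then show ?thesis
      using sgn by (intro that[of 1]) (auto simp: sgn_zero_iff)
  next
    case False
    then have "quad_form a / quad_form b > 0"
      using sgn by (auto simp: sgn_if zero_less_divide_iff split: if_splits)
    then show ?thesis
      using False by (intro that[of "sqrt (quad_form a / quad_form b)"]) (auto simp: quad_form_scaleR)
  qed
  have "r *\<^sub>R b \<noteq> 0"
    using r(1) assms(2) by simp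
  then obtain M where M: "M \<in> carrier pseudo_orthogonal_group" "M a = r *\<^sub>R b"
    using r(2) assms(1) nonnull_vectors_equivalent[of a "r *\<^sub>R b"]
      null_vectors_equivalent[of a "r *\<^sub>R b"] by metis
  moreover have "polar_section (r *\<^sub>R b) = polar_section b"
    using r(1) by (simp add: polar_section_def polar_hyperplane_scaleR)
  ultimately have "projective_image M (polar_section a) = polar_section b"
    by (simp add: projective_image_polar_section)
  with M(1) show ?thesis
    by blast
qed

section \<open>The action on hypersurfaces and its orbits\<close>

lemma conformal_hypersurfaces_equivalent_iff:
  assumes "H \<in> conformal_hypersurfaces" and "H' \<in> conformal_hypersurfaces"
  shows "(\<exists>M \<in> carrier pseudo_orthogonal_group. projective_image M H = H') \<longleftrightarrow>
    hypersurface_sign H = hypersurface_sign H'"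
proof
  assume "\<exists>M \<in> carrier pseudo_orthogonal_group. projective_image M H = H'"
  then show "hypersurface_sign H = hypersurface_sign H'"
    using assms(1) projective_image_conformal_hypersurface(2) by metis
next
  assume sign: "hypersurface_sign H = hypersurface_sign H'"
  obtain a b where ab: "admissible_vector a" "H = polar_section a"
    "admissible_vector b" "H' = polar_section b"
    using assms by (auto simp: conformal_hypersurfaces_eq)
  then show "\<exists>M \<in> carrier pseudo_orthogonal_group. projective_image M H = H'"
    using polar_sections_equivalent[of a b] sign
    by (simp add: hypersurface_sign_polar_section admissible_vector_def)
qed

lemma group_action_hypersurface_action:
  "group_action (pseudo_orthogonal_group :: (('m::finite, 'n::finite) pspace \<Rightarrow> _) monoid)
    conformal_hypersurfaces hypersurface_action"
proof -
  have Bij: "hypersurface_action M \<in> Bij conformal_hypersurfaces"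
    if "M \<in> carrier pseudo_orthogonal_group" for M :: "('m, 'n) pspace \<Rightarrow> ('m, 'n) pspace"
    using projective_image_conformal_hypersurfaces[OF that]
    by (auto simp: Bij_def hypersurface_action_def cong: bij_betw_cong)
  have "hypersurface_action (M \<circ> N) =
      compose conformal_hypersurfaces (hypersurface_action M) (hypersurface_action N)"
    if "N \<in> carrier pseudo_orthogonal_group" for M N :: "('m, 'n) pspace \<Rightarrow> ('m, 'n) pspace"
    using projective_image_conformal_hypersurface(1)[OF that]
    by (auto simp: hypersurface_action_def compose_def projective_image_comp fun_eq_iff)
  with Bij show ?thesis
    by (auto simp: group_action_def group_hom_def group_hom_axioms_def hom_def BijGroup_def
        mult_pseudo_orthogonal_group group_pseudo_orthogonal_group
        intro: group_BijGroup[unfolded BijGroup_def])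
qed

lemma orbit_eq_same_sign:
  assumes "H \<in> conformal_hypersurfaces"
  shows "orbit pseudo_orthogonal_group hypersurface_action H =
    {H' \<in> conformal_hypersurfaces. hypersurface_sign H' = hypersurface_sign H}"
proof -
  have "orbit pseudo_orthogonal_group hypersurface_action H =
      {H'. \<exists>M \<in> carrier pseudo_orthogonal_group. projective_image M H = H'}"
    using assms by (auto simp: orbit_def hypersurface_action_def)
  also have "\<dots> = {H' \<in> conformal_hypersurfaces.
      \<exists>M \<in> carrier pseudo_orthogonal_group. projective_image M H = H'}"
    using assms projective_image_conformal_hypersurface(1) by blast
  also have "\<dots> = {H' \<in> conformal_hypersurfaces. hypersurface_sign H = hypersurface_sign H'}"
    using conformal_hypersurfaces_equivalent_iff[OF assms] by blast
  finally show ?thesis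
    by (simp add: eq_commute)
qed

text \<open>The orbits are the non-empty fibres of the sign.\<close>

lemma card_orbits_eq_card_signs:
  "card (orbits (pseudo_orthogonal_group :: (('m::finite, 'n::finite) pspace \<Rightarrow> _) monoid)
      conformal_hypersurfaces hypersurface_action) =
    card (hypersurface_sign ` (conformal_hypersurfaces :: ('m, 'n) pspace set set set))"
proof -
  let ?E = "conformal_hypersurfaces :: ('m, 'n) pspace set set set"
  let ?F = "\<lambda>s. {H \<in> ?E. hypersurface_sign H = s}"
  have "orbits pseudo_orthogonal_group ?E hypersurface_action =
      orbit pseudo_orthogonal_group hypersurface_action ` ?E"
    by (auto simp: orbits_def)
  also have "\<dots> = ?F ` hypersurface_sign ` ?E"
    unfolding image_image by (intro image_cong refl orbit_eq_same_sign)
  finally have "orbits pseudo_orthogonal_group ?E hypersurface_action = ?F ` hypersurface_sign ` ?E" .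
  moreover have "inj_on ?F (hypersurface_sign ` ?E)"
    by (rule inj_onI) blast
  ultimately show ?thesis
    by (simp add: card_image)
qed

text \<open>With at least two coordinates in each part every non-zero vector is admissible, and pairs of unit
  or zero vectors realise the three signs.\<close>

lemma hypersurface_signs_indefinite:
  assumes m: "CARD('m::finite) \<noteq> 1" and n: "CARD('n::finite) \<noteq> 1"
  shows "hypersurface_sign ` (conformal_hypersurfaces :: ('m, 'n) pspace set set set) = {-1, 0, 1}"
    (is "?S = _")
proof
  show "?S \<subseteq> {-1, 0, 1}"
  proof
    fix s
    assume "s \<in> ?S"
    then obtain a :: "('m, 'n) pspace" where "s = sgn (quad_form a)"
      by (auto simp: conformal_hypersurfaces_eq hypersurface_sign_polar_section)
    then show "s \<in> {-1, 0, 1}"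
      by (simp add: sgn_if)
  qed
next
  obtain x :: "real ^ 'm" where x: "norm x = 1"
    by (rule vector_choose_size[of 1]) auto
  obtain y :: "real ^ 'n" where y: "norm y = 1"
    by (rule vector_choose_size[of 1]) auto
  have sign: "sgn (quad_form a) \<in> ?S" if "a \<noteq> 0" for a :: "('m, 'n) pspace"
  proof -
    have "admissible_vector a"
      using that m n by (simp add: admissible_vector_def)
    then have "hypersurface_sign (polar_section a) = sgn (quad_form a)"
      and "polar_section a \<in> conformal_hypersurfaces"
      by (auto simp: hypersurface_sign_polar_section conformal_hypersurfaces_eq)
    then show ?thesis
      by (metis imageI)
  qed
  have nonzero: "join_parts v w \<noteq> 0" if "v \<noteq> 0 \<or> w \<noteq> 0" for v :: "real ^ 'm" and w :: "real ^ 'n"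
    using that by (metis neg_part_join neg_part_zero pos_part_join pos_part_zero)
  have "x \<noteq> 0" "y \<noteq> 0"
    using x y by auto
  then have "join_parts (0 :: real ^ 'm) y \<noteq> 0" "join_parts x y \<noteq> 0"
    "join_parts x (0 :: real ^ 'n) \<noteq> 0"
    by (simp_all add: nonzero)
  from this[THEN sign] have "-1 \<in> ?S" "0 \<in> ?S" "1 \<in> ?S"
    using x y by (simp_all add: quad_form_parts)
  then show "{-1, 0, 1} \<subseteq> ?S"
    by blast
qed

theorem theorem14:
  fixes p q :: nat
  assumes "CARD('m::finite) = p + 1" and "CARD('n::finite) = q + 1" and "p + q \<ge> 2"
  shows
    "(\<forall>M \<in> carrier (pseudo_orthogonal_group :: (('m, 'n) pspace \<Rightarrow> ('m, 'n) pspace) monoid).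
        projective_image M ` conformal_hypersurfaces = conformal_hypersurfaces) \<and>
     (\<forall>H \<in> (conformal_hypersurfaces :: ('m, 'n) pspace set set set).
        \<forall>H' \<in> conformal_hypersurfaces.
          (\<exists>M \<in> carrier pseudo_orthogonal_group. projective_image M H = H') \<longleftrightarrow>
            hypersurface_sign H = hypersurface_sign H') \<and>
     (p = 0 \<or> q = 0 \<longrightarrow>
        transitive_action
          (pseudo_orthogonal_group :: (('m, 'n) pspace \<Rightarrow> ('m, 'n) pspace) monoid)
          conformal_hypersurfaces hypersurface_action) \<and>
     (p \<noteq> 0 \<and> q \<noteq> 0 \<longrightarrow>
        card (orbits
          (pseudo_orthogonal_group :: (('m, 'n) pspace \<Rightarrow> ('m, 'n) pspace) monoid)
          conformal_hypersurfaces hypersurface_action) = 3)"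
proof (intro conjI ballI impI)
  show "projective_image M ` conformal_hypersurfaces = conformal_hypersurfaces"
    if "M \<in> carrier pseudo_orthogonal_group" for M :: "('m, 'n) pspace \<Rightarrow> ('m, 'n) pspace"
    using projective_image_conformal_hypersurfaces[OF that] by (simp add: bij_betw_def)
  show "(\<exists>M \<in> carrier pseudo_orthogonal_group. projective_image M H = H') \<longleftrightarrow>
      hypersurface_sign H = hypersurface_sign H'"
    if "H \<in> conformal_hypersurfaces" "H' \<in> conformal_hypersurfaces"
    for H H' :: "('m, 'n) pspace set set"
    using that by (rule conformal_hypersurfaces_equivalent_iff)
next
  assume "p = 0 \<or> q = 0"
  then consider "CARD('n) = 1" | "CARD('m) = 1"
    using assms by auto
  then have sign: "hypersurface_sign H = hypersurface_sign H'"
    if HH': "H \<in> conformal_hypersurfaces" "H' \<in> conformal_hypersurfaces"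
    for H H' :: "('m, 'n) pspace set set"
    using HH'
    by cases (auto simp: conformal_hypersurfaces_eq hypersurface_sign_polar_section
        admissible_vector_def)
  have "\<exists>M \<in> carrier pseudo_orthogonal_group. hypersurface_action M H = H'"
    if HH': "H \<in> conformal_hypersurfaces" "H' \<in> conformal_hypersurfaces"
    for H H' :: "('m, 'n) pspace set set"
    using conformal_hypersurfaces_equivalent_iff[OF HH'] sign[OF HH'] HH'
    by (simp add: hypersurface_action_def)
  then show "transitive_action
      (pseudo_orthogonal_group :: (('m, 'n) pspace \<Rightarrow> ('m, 'n) pspace) monoid)
      conformal_hypersurfaces hypersurface_action"
    by (intro transitive_action.intro transitive_action_axioms.intro
        group_action_hypersurface_action)
next
  assume "p \<noteq> 0 \<and> q \<noteq> 0"
  then have "CARD('m) \<noteq> 1" "CARD('n) \<noteq> 1"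
    using assms by auto
  then show "card (orbits
      (pseudo_orthogonal_group :: (('m, 'n) pspace \<Rightarrow> ('m, 'n) pspace) monoid)
      conformal_hypersurfaces hypersurface_action) = 3"
    by (simp add: card_orbits_eq_card_signs hypersurface_signs_indefinite)
qed

end
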